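(* Let $p$ and $q$ be probability density functions in $\mathcal{G}$ with respective supports $S_p$ and $S_q$. Let $S_q\subseteq S_p$ and define $$r(p,q)(x) := \left(\frac{p'(x)}{p(x)}-\frac{q'(x)}{q(x)}\right)\mathbb{I}_{S_q}(x).$$ Suppose that $\mathcal{F}(p)\cap\mathcal{F}(q)\neq\emptyset$. Then, for all $f\in\mathcal{F}(p)\cap\mathcal{F}(q)$, we have (at every $x$ where the derivatives involved are defined) $$\mathcal{T}_pf(x)=\mathcal{T}_qf(x)+f(x)\,r(p,q)(x)+\mathcal{T}_pf(x)\,\mathbb{I}_{S_p\setminus S_q}(x),$$ and therefore $$\mathrm{E}_q[\mathcal{T}_pf(X)]=\mathrm{E}_q[f(X)\,r(p,q)(X)].$$
   Context: $\mathcal{G}$ is the collection of positive real functions $x\mapsto p(x)$ such that (i) the support $S_p := \{x \in \mathbb{R} : p(x) \text{ (exists and) is positive}\}$ is an interval with closure $\bar S_p=[a,b]$ for some $-\infty\le a<b\le\infty$; (ii) $p$ is differentiable (in the usual sense) at every point of $(a,b)$, with derivative $p'$; (iii) $\int_{S_p}p(y)\,dy=1$. Conventions: $\frac{1}{p(x)}$ is understood to be $0$ when $x\notin S_p$; $\mathbb{I}_A$ is the indicator function of $A$; for $p\in\mathcal{G}$, $\mathrm{E}_p[l(X)]:=\int_{S_p}l(x)p(x)\,dx$. The same notation applies with $q$ in place of $p$. For $p\in\mathcal{G}$ with $\bar S_p=[a,b]$, the class of test functions $\mathcal{F}(p)$ is the collection of functions $f:\mathbb{R}\to\mathbb{R}$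 such that $x\mapsto f(x)p(x)$ is differentiable on the interior of $S_p$ and $f(a^+)p(a^+)=f(b^-)p(b^-)=0$ (that is, $f(x)p(x)\to 0$ as $x\to a^+$ and as $x\to b^-$). The Stein operator $\mathcal{T}_p$ maps $f\in\mathcal{F}(p)$ to the function $\mathcal{T}_pf:\mathbb{R}\to\mathbb{R}$, $\mathcal{T}_pf(x):=\frac{1}{p(x)}\left.\frac{d}{dy}(f(y)p(y))\right|_{y=x}$ (hence $\mathcal{T}_pf(x)=0$ for $x\notin S_p$). *)

theory Defs
  imports "HOL-Analysis.Analysis"
begin

text \<open>A point at which a density is not defined is encoded by the value 0, so that densities
  are total nonnegative functions.\<close>

definition supp :: "(real \<Rightarrow> real) \<Rightarrow> real set" where
  "supp p = {x. p x > 0}"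

definition lend :: "(real \<Rightarrow> real) \<Rightarrow> ereal" where
  "lend p = Inf (ereal ` supp p)"

definition rend :: "(real \<Rightarrow> real) \<Rightarrow> ereal" where
  "rend p = Sup (ereal ` supp p)"

text \<open>The closure of an interval is determined by its infimum and supremum, see
  \<open>closure_supp\<close> below; \<open>einterval a b\<close> is the open interval with extended real end points.\<close>

definition dens_class :: "(real \<Rightarrow> real) set" where
  "dens_class = {p. (\<forall>x. p x \<ge> 0) \<and> is_interval (supp p) \<and> lend p < rend p \<and>
     (\<forall>x \<in> einterval (lend p) (rend p). p differentiable (at x)) \<and>
     (p has_integral 1) (supp p)}"

lemma closure_supp:
  assumes "is_interval (supp p)" and "lend p < rend p"
  shows "closure (supp p) = {x. lend p \<le> ereal x \<and> ereal x \<le> rend p}"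
    and "interior (supp p) = einterval (lend p) (rend p)"
proof -
  let ?S = "supp p" and ?C = "{x. lend p \<le> ereal x \<and> ereal x \<le> rend p}"
  have I: "einterval (lend p) (rend p) \<subseteq> ?S"
  proof
    fix x assume "x \<in> einterval (lend p) (rend p)"
    then have "lend p < ereal x" "ereal x < rend p" by (auto simp: einterval_def)
    then obtain u v where "u \<in> ?S" "v \<in> ?S" "u < x" "x < v"
      by (auto simp: lend_def rend_def Inf_less_iff less_Sup_iff)
    then show "x \<in> ?S" using assms(1) by (meson is_interval_1 less_imp_le)
  qed
  have S: "?S \<subseteq> ?C" by (auto simp: lend_def rend_def intro: Inf_lower Sup_upper)
  have cl: "closed ?C"
    by (intro closed_Collect_conj closed_Collect_le continuous_intros continuous_on_ereal)
  have "?C \<subseteq> closure (einterval (lend p) (rend p))"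
  proof
    fix x assume x: "x \<in> ?C"
    obtain m where m: "lend p < ereal m" "ereal m < rend p" using ereal_dense2[OF assms(2)] by blast
    show "x \<in> closure (einterval (lend p) (rend p))"
    proof (cases "x = m")
      case True
      then show ?thesis using m closure_subset by (fastforce simp: einterval_def)
    next
      case False
      have seg: "open_segment x m \<subseteq> einterval (lend p) (rend p)"
      proof
        fix y assume "y \<in> open_segment x m"
        then have "x < y \<and> y < m \<or> m < y \<and> y < x"
          by (auto simp: open_segment_eq_real_ivl split: if_splits)
        then show "y \<in> einterval (lend p) (rend p)"
          using x m by (auto simp: einterval_def)
            (metis ereal_less_ereal_Ex less_ereal.simps(1) order_le_less_trans order_less_le_trans less_trans)+
      qed
      have "x \<in> closure (open_segment x m)" using False by (simp add: closure_open_segment)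
      then show ?thesis using closure_mono[OF seg] by blast
    qed
  qed
  then show C: "closure ?S = ?C"
    using closure_mono[OF I] closure_minimal[OF S cl] by blast
  show "interior ?S = einterval (lend p) (rend p)"
  proof
    show "einterval (lend p) (rend p) \<subseteq> interior ?S" by (rule interior_maximal[OF I open_einterval])
    show "interior ?S \<subseteq> einterval (lend p) (rend p)"
    proof
      fix x assume "x \<in> interior ?S"
      then obtain e where e: "e > 0" "cball x e \<subseteq> ?S" by (meson mem_interior_cball)
      then have "x - e \<in> ?S" "x + e \<in> ?S" by (auto simp: dist_real_def subset_iff)
      then have "lend p \<le> ereal (x - e)" "ereal (x + e) \<le> rend p" using S by auto
      moreover have "ereal (x - e) < ereal x" "ereal x < ereal (x + e)" using e by auto
      ultimately show "x \<in> einterval (lend p) (rend p)"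
        unfolding einterval_def mem_Collect_eq by (metis order_le_less_trans order_less_le_trans)
    qed
  qed
qed

text \<open>One-sided limits are taken in the extended reals, so that \<open>at_right (-\<infinity>)\<close> and
  \<open>at_left \<infinity>\<close> cover unbounded supports.\<close>

definition test_class :: "(real \<Rightarrow> real) \<Rightarrow> (real \<Rightarrow> real) set" where
  "test_class p = {f.
     (\<forall>x \<in> interior (supp p). (\<lambda>y. f y * p y) differentiable (at x)) \<and>
     (((\<lambda>y. f y * p y) \<circ> real_of_ereal) \<longlongrightarrow> 0) (at_right (lend p)) \<and>
     (((\<lambda>y. f y * p y) \<circ> real_of_ereal) \<longlongrightarrow> 0) (at_left (rend p))}"

definition stein_op :: "(real \<Rightarrow> real) \<Rightarrow> (real \<Rightarrow> real) \<Rightarrow> real \<Rightarrow> real" where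
  "stein_op p f x = (if x \<in> supp p then 1 / p x else 0) * deriv (\<lambda>y. f y * p y) x"

definition score_diff :: "(real \<Rightarrow> real) \<Rightarrow> (real \<Rightarrow> real) \<Rightarrow> real \<Rightarrow> real" where
  "score_diff p q x = (deriv p x / p x - deriv q x / q x) * indicator (supp q) x"

text \<open>Expectations use the Henstock--Kurzweil integral. It agrees with the Lebesgue integral
  whenever the latter exists (\<open>expect_eq_lebesgue\<close> below), and it also covers
  conditionally convergent integrals: the derivative of \<open>f q\<close> integrates to 0 over the
  support of \<open>q\<close>, but it need not be absolutely integrable.\<close>

definition has_expect :: "(real \<Rightarrow> real) \<Rightarrow> (real \<Rightarrow> real) \<Rightarrow> bool" where
  "has_expect p l \<longleftrightarrow> (\<lambda>x. l x * p x) integrable_on supp p"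

definition expect :: "(real \<Rightarrow> real) \<Rightarrow> (real \<Rightarrow> real) \<Rightarrow> real" where
  "expect p l = integral (supp p) (\<lambda>x. l x * p x)"

lemma expect_eq_lebesgue:
  assumes "set_integrable lborel (supp p) (\<lambda>x. l x * p x)"
  shows "has_expect p l" and "expect p l = (LINT x:supp p|lborel. l x * p x)"
  using set_borel_integral_eq_integral[OF assms] by (simp_all add: has_expect_def expect_def)

end

theory Submission
  imports Defs
begin

text \<open>
  Where \<open>p\<close> is positive and both \<open>p\<close> and \<open>f p\<close> are differentiable, so is \<open>f = f p / p\<close>, and the
  product rule splits the Stein operator into \<open>f' + f p' / p\<close>
  (\<open>stein_op_eq_deriv_plus_score\<close>). The first summand does not depend on the density. On
  \<open>supp q\<close>, which lies in \<open>supp p\<close>, the difference of the two operators is therefore \<open>f\<close> times the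
  difference of the scores. On the rest of \<open>supp p\<close> the correction term restores \<open>stein_op p f\<close>,
  and elsewhere every term vanishes.

  For the expectations, multiply the pointwise identity by \<open>q\<close>: inside \<open>supp q\<close> the integrands
  \<open>stein_op p f \<cdot> q\<close> and \<open>f \<cdot> score_diff p q \<cdot> q\<close> differ by \<open>(f q)'\<close>. Since \<open>f q\<close> vanishes at both
  ends of \<open>supp q\<close>, this derivative has integral 0. It need not be absolutely integrable, even over
  a bounded support, so this step rests on a fundamental theorem of calculus for the
  Henstock--Kurzweil integral over an arbitrary open interval with extended real end points
  (\<open>has_integral_derivative_einterval\<close>). Adding a function of integral 0 changes neither the
  existence nor the value of an integral; both claims about expectations follow together.
\<close>

section \<open>The fundamental theorem of calculus on unbounded intervals\<close>

text \<open>The Henstock--Kurzweil integral over the line is the limit of the integrals over large compact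
  intervals, so the proper theorem on \<open>{u..v}\<close> passes to the limit, with no integrability
  hypothesis on the derivative.\<close>

lemma has_integral_derivative_UNIV:
  fixes G :: "real \<Rightarrow> 'a::banach"
  assumes S: "finite S"
    and deriv: "\<And>x. x \<notin> S \<Longrightarrow> (G has_vector_derivative g x) (at x)"
    and cont: "\<And>x. isCont G x"
    and bot: "(G \<longlongrightarrow> A) at_bot" and top: "(G \<longlongrightarrow> B) at_top"
  shows "(g has_integral (B - A)) UNIV"
proof (subst has_integral', intro allI impI)
  fix e :: real assume e: "e > 0"
  obtain M where M: "\<And>x. x \<le> M \<Longrightarrow> dist (G x) A < e / 2"
    using tendstoD[OF bot, of "e / 2"] e by (auto simp: eventually_at_bot_linorder)
  obtain N where N: "\<And>x. x \<ge> N \<Longrightarrow> dist (G x) B < e / 2"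
    using tendstoD[OF top, of "e / 2"] e by (auto simp: eventually_at_top_linorder)
  \<comment> \<open>A ball is open; radius \<open>R + 1\<close> keeps \<open>R\<close> and \<open>- R\<close> inside it, so that \<open>u \<le> - R\<close> and \<open>R \<le> v\<close>.\<close>
  define R where "R = \<bar>M\<bar> + \<bar>N\<bar> + 1"
  have "\<exists>z. ((\<lambda>x. if x \<in> UNIV then g x else 0) has_integral z) (cbox u v) \<and> norm (z - (B - A)) < e"
    if uv: "ball 0 (R + 1) \<subseteq> cbox u v" for u v
  proof -
    have "R \<in> ball 0 (R + 1)" "- R \<in> ball 0 (R + 1)"
      by (auto simp: R_def)
    then have "R \<in> cbox u v" "- R \<in> cbox u v"
      using uv by blast+
    then have uv': "u \<le> M" "N \<le> v" "u \<le> v"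
      by (auto simp: R_def)
    have "(g has_integral (G v - G u)) {u..v}"
      using S uv'(3) deriv cont
      by (intro fundamental_theorem_of_calculus_interior_strong)
        (auto intro: continuous_at_imp_continuous_on)
    moreover have "norm ((G v - G u) - (B - A)) < e"
    proof -
      have "norm ((G v - G u) - (B - A)) = norm ((G v - B) - (G u - A))"
        by (simp add: algebra_simps)
      also have "\<dots> \<le> dist (G v) B + dist (G u) A"
        unfolding dist_norm by (rule norm_triangle_ineq4)
      also have "\<dots> < e"
        using M[OF uv'(1)] N[OF uv'(2)] by simp
      finally show ?thesis .
    qed
    ultimately show ?thesis
      by auto
  qed
  moreover have "R + 1 > 0"
    by (simp add: R_def)
  ultimately show "\<exists>b>0. \<forall>u v. ball 0 b \<subseteq> cbox u v \<longrightarrow>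
      (\<exists>z. ((\<lambda>x. if x \<in> UNIV then g x else 0) has_integral z) (cbox u v) \<and> norm (z - (B - A)) < e)"
    by blast
qed

text \<open>Extending \<open>F\<close> by its two boundary values, and its derivative by 0, gives a continuous function
  on the whole line that is differentiable except possibly at the finite end points. This treats
  finite and infinite end points alike and reduces the claim to
  \<open>has_integral_derivative_UNIV\<close>.\<close>

lemma has_integral_derivative_einterval:
  fixes F :: "real \<Rightarrow> 'a::banach"
  assumes ab: "a < b"
    and deriv: "\<And>x. x \<in> einterval a b \<Longrightarrow> (F has_vector_derivative f x) (at x)"
    and left: "((F \<circ> real_of_ereal) \<longlongrightarrow> A) (at_right a)"
    and right: "((F \<circ> real_of_ereal) \<longlongrightarrow> B) (at_left b)"
  shows "(f has_integral (B - A)) (einterval a b)"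
proof -
  define G where "G x = (if ereal x \<le> a then A else if b \<le> ereal x then B else F x)" for x
  define g where "g x = (if x \<in> einterval a b then f x else 0)" for x
  define S where "S = {x. ereal x = a \<or> ereal x = b}"
  have "S \<subseteq> {real_of_ereal a, real_of_ereal b}"
    by (auto simp: S_def)
  then have S: "finite S"
    using finite_subset by blast
  have G_below: "G x = A" if "ereal x \<le> a" for x
    using that by (simp add: G_def)
  have G_above: "G x = B" if "b \<le> ereal x" for x
    using that ab by (auto simp: G_def)
  have G_in: "G x = F x" if "x \<in> einterval a b" for x
    using that by (auto simp: G_def einterval_def)
  have open_below: "open {x. ereal x < a}" and open_above: "open {x. b < ereal x}"
    and open_lt_b: "open {x. ereal x < b}" and open_gt_a: "open {x. a < ereal x}"
    by (intro open_Collect_less continuous_intros continuous_on_ereal)+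
  have G_deriv: "(G has_vector_derivative g x) (at x)" if "x \<notin> S" for x
  proof -
    consider "ereal x < a" | "b < ereal x" | "x \<in> einterval a b"
      using \<open>x \<notin> S\<close> unfolding S_def einterval_def by force
    then show ?thesis
    proof cases
      case 1
      then have "g x = 0"
        by (auto simp: g_def einterval_def)
      moreover have "(G has_vector_derivative 0) (at x)"
        by (rule has_vector_derivative_transform_within_open[OF has_vector_derivative_const[of A]
              open_below]) (use 1 in \<open>auto simp: G_below\<close>)
      ultimately show ?thesis
        by simp
    next
      case 2
      then have "g x = 0"
        by (auto simp: g_def einterval_def)
      moreover have "(G has_vector_derivative 0) (at x)"
        by (rule has_vector_derivative_transform_within_open[OF has_vector_derivative_const[of B]
              open_above]) (use 2 in \<open>auto simp: G_above\<close>)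
      ultimately show ?thesis
        by simp
    next
      case 3
      then show ?thesis
        using has_vector_derivative_transform_within_open[OF deriv[OF 3] open_einterval 3, of G]
        by (simp add: G_in g_def)
    qed
  qed
  have cont: "isCont G x" for x
  proof (cases "x \<in> S")
    case False
    then show ?thesis
      using G_deriv has_vector_derivative_continuous by blast
  next
    case True
    then consider "ereal x = a" | "ereal x = b"
      by (auto simp: S_def)
    then show ?thesis
    proof cases
      case 1
      have "(G \<longlongrightarrow> A) (at_left x)"
        by (rule tendsto_eventually)
          (simp add: eventually_at_filter G_below 1[symmetric])
      moreover have "(G \<longlongrightarrow> A) (at_right x)"
      proof (rule Lim_transform_eventually)
        show "(F \<longlongrightarrow> A) (at_right x)"
          using left unfolding 1[symmetric] ereal_tendsto_simps1 .
        have "\<forall>\<^sub>F y in nhds x. y \<in> {y. ereal y < b}"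
          using open_lt_b 1 ab by (intro eventually_nhds_in_open) simp_all
        then show "\<forall>\<^sub>F y in at_right x. F y = G y"
          unfolding eventually_at_filter
          by eventually_elim (simp add: G_in einterval_def 1[symmetric])
      qed
      ultimately show ?thesis
        using 1 by (auto simp: isCont_def filterlim_split_at G_below)
    next
      case 2
      have "(G \<longlongrightarrow> B) (at_right x)"
        by (rule tendsto_eventually)
          (simp add: eventually_at_filter G_above 2[symmetric])
      moreover have "(G \<longlongrightarrow> B) (at_left x)"
      proof (rule Lim_transform_eventually)
        show "(F \<longlongrightarrow> B) (at_left x)"
          using right unfolding 2[symmetric] ereal_tendsto_simps1 .
        have "\<forall>\<^sub>F y in nhds x. y \<in> {y. a < ereal y}"
          using open_gt_a 2 ab by (intro eventually_nhds_in_open) simp_all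
        then show "\<forall>\<^sub>F y in at_left x. F y = G y"
          unfolding eventually_at_filter
          by eventually_elim (simp add: G_in einterval_def 2[symmetric])
      qed
      ultimately show ?thesis
        using 2 by (auto simp: isCont_def filterlim_split_at G_above)
    qed
  qed
  \<comment> \<open>When \<open>a = -\<infinity>\<close>, points below \<open>m\<close> lie in the interval, where \<open>G\<close> is \<open>F\<close>; likewise above \<open>m\<close> when
    \<open>b = \<infinity>\<close>.\<close>
  obtain m where m: "a < ereal m" "ereal m < b"
    using ereal_dense2[OF ab] by blast
  have bot: "(G \<longlongrightarrow> A) at_bot"
  proof (cases "a = -\<infinity>")
    case True
    have "(F \<longlongrightarrow> A) at_bot"
      using left by (simp add: True ereal_tendsto_simps1)
    moreover have "\<forall>\<^sub>F x in at_bot. F x = G x"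
      using eventually_le_at_bot[of m]
    proof eventually_elim
      case (elim x)
      then have "ereal x \<le> ereal m"
        by simp
      with m(2) have "ereal x < b"
        by (rule order_le_less_trans[rotated])
      with True show ?case
        by (simp add: G_in einterval_def)
    qed
    ultimately show ?thesis
      by (rule Lim_transform_eventually)
  next
    case False
    with m obtain r where r: "a = ereal r"
      by (cases a) auto
    have "\<forall>\<^sub>F x in at_bot. G x = A"
      using eventually_le_at_bot[of r] by eventually_elim (simp add: G_below r)
    then show ?thesis
      by (rule tendsto_eventually)
  qed
  have top: "(G \<longlongrightarrow> B) at_top"
  proof (cases "b = \<infinity>")
    case True
    have "(F \<longlongrightarrow> B) at_top"
      using right by (simp add: True ereal_tendsto_simps1)
    moreover have "\<forall>\<^sub>F x in at_top. F x = G x"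
      using eventually_ge_at_top[of m]
    proof eventually_elim
      case (elim x)
      then have "ereal m \<le> ereal x"
        by simp
      with m(1) have "a < ereal x"
        by (rule order_less_le_trans)
      with True show ?case
        by (simp add: G_in einterval_def)
    qed
    ultimately show ?thesis
      by (rule Lim_transform_eventually)
  next
    case False
    with m obtain r where r: "b = ereal r"
      by (cases b) auto
    have "\<forall>\<^sub>F x in at_top. G x = B"
      using eventually_ge_at_top[of r] by eventually_elim (simp add: G_above r)
    then show ?thesis
      by (rule tendsto_eventually)
  qed
  have "(g has_integral (B - A)) UNIV"
    by (rule has_integral_derivative_UNIV[OF S G_deriv cont bot top])
  then show ?thesis
    unfolding g_def by (simp only: has_integral_restrict_UNIV)
qed

section \<open>Comparing Stein operators pointwise\<close>

text \<open>By continuity \<open>p\<close> is positive near \<open>x\<close>, so there \<open>f\<close> is the quotient of \<open>f p\<close> by \<open>p\<close> and inherits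
  differentiability. Hence the product rule applies, although test functions are only required to
  have differentiable products with the density.\<close>

lemma stein_op_eq_deriv_plus_score:
  assumes fp: "(\<lambda>y. f y * p y) differentiable (at x)" and p: "p differentiable (at x)"
    and pos: "p x > 0"
  shows "stein_op p f x = deriv f x + f x * (deriv p x / p x)"
proof -
  have "(\<lambda>y. f y * p y / p y) differentiable (at x)"
    using fp p pos by (intro differentiable_divide) auto
  then obtain D where D: "((\<lambda>y. f y * p y / p y) has_real_derivative D) (at x)"
    by (auto simp: real_differentiable_def)
  have "isCont p x"
    using p by (rule differentiable_imp_continuous_within)
  then have "\<forall>\<^sub>F y in nhds x. p y > 0"
    using pos unfolding isCont_def tendsto_at_iff_tendsto_nhds by (rule order_tendstoD(1))
  then have "\<forall>\<^sub>F y in nhds x. f y * p y / p y = f y"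
    by eventually_elim simp
  then have f: "(f has_real_derivative D) (at x)"
    by (rule iffD1[OF DERIV_cong_ev[OF refl _ refl] D])
  have "(p has_real_derivative deriv p x) (at x)"
    using p by (auto simp: real_differentiable_def dest: DERIV_imp_deriv)
  from DERIV_mult[OF f this] have "deriv (\<lambda>y. f y * p y) x = D * p x + deriv p x * f x"
    by (rule DERIV_imp_deriv)
  then show ?thesis
    using pos DERIV_imp_deriv[OF f] by (simp add: stein_op_def supp_def field_simps)
qed

lemma stein_op_eq_on_supp:
  assumes "(\<lambda>y. f y * p y) differentiable (at x)" "(\<lambda>y. f y * q y) differentiable (at x)"
    and "p differentiable (at x)" "q differentiable (at x)"
    and "x \<in> supp p" "x \<in> supp q"
  shows "stein_op p f x = stein_op q f x + f x * score_diff p q x"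
  using assms
  by (simp add: stein_op_eq_deriv_plus_score score_diff_def supp_def algebra_simps)

section \<open>Comparing expectations\<close>

text \<open>This is \<open>E\<^sub>q[T\<^sub>q f] = 0\<close>: the integrand is \<open>(f q)'\<close>, and \<open>f q\<close> vanishes at both ends.\<close>

lemma has_integral_stein_op:
  assumes q: "q \<in> dens_class" and f: "f \<in> test_class q"
  shows "((\<lambda>x. stein_op q f x * q x) has_integral 0) (interior (supp q))"
proof -
  have int: "interior (supp q) = einterval (lend q) (rend q)" and ends: "lend q < rend q"
    using q closure_supp(2)[of q] by (auto simp: dens_class_def)
  have "((\<lambda>x. deriv (\<lambda>y. f y * q y) x) has_integral (0 - 0)) (einterval (lend q) (rend q))"
  proof (rule has_integral_derivative_einterval[OF ends])
    fix x assume "x \<in> einterval (lend q) (rend q)"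
    then have "(\<lambda>y. f y * q y) differentiable (at x)"
      using f int by (auto simp: test_class_def)
    then show "((\<lambda>y. f y * q y) has_vector_derivative deriv (\<lambda>y. f y * q y) x) (at x)"
      by (auto simp: real_differentiable_def has_real_derivative_iff_has_vector_derivative[symmetric]
          dest: DERIV_imp_deriv)
  qed (use f in \<open>auto simp: test_class_def\<close>)
  then have "((\<lambda>x. deriv (\<lambda>y. f y * q y) x) has_integral 0) (interior (supp q))"
    by (simp add: int)
  then show ?thesis
  proof (rule has_integral_eq[rotated])
    fix x assume "x \<in> interior (supp q)"
    then have "x \<in> supp q"
      using interior_subset by blast
    then show "deriv (\<lambda>y. f y * q y) x = stein_op q f x * q x"
      by (simp add: stein_op_def supp_def)
  qed
qed

text \<open>At an end point that belongs to \<open>supp q\<close> the derivatives need not exist, so the pointwise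
  identity is available in the interior only; the end points form a null set. Quantifying over
  all candidate values \<open>I\<close> captures existence and value of the expectation at once.\<close>

lemma has_integral_stein_op_iff_score:
  assumes p: "p \<in> dens_class" and q: "q \<in> dens_class" and sub: "supp q \<subseteq> supp p"
    and fp: "f \<in> test_class p" and fq: "f \<in> test_class q"
  shows "((\<lambda>x. stein_op p f x * q x) has_integral I) (supp q) \<longleftrightarrow>
    ((\<lambda>x. f x * score_diff p q x * q x) has_integral I) (supp q)"
proof -
  let ?U = "interior (supp q)"
  have intp: "interior (supp p) = einterval (lend p) (rend p)"
    and intq: "?U = einterval (lend q) (rend q)"
    using p q closure_supp(2) by (auto simp: dens_class_def)
  have Usub: "?U \<subseteq> interior (supp p)"
    using sub by (rule interior_mono)
  have eq: "stein_op p f x * q x = f x * score_diff p q x * q x + stein_op q f x * q x"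
    if x: "x \<in> ?U" for x
  proof -
    have "stein_op p f x = stein_op q f x + f x * score_diff p q x"
    proof (rule stein_op_eq_on_supp)
      show "(\<lambda>y. f y * p y) differentiable (at x)" "(\<lambda>y. f y * q y) differentiable (at x)"
        using fp fq x Usub by (auto simp: test_class_def)
      show "p differentiable (at x)" "q differentiable (at x)"
        using p q x Usub intp intq by (auto simp: dens_class_def)
      show "x \<in> supp p" "x \<in> supp q"
        using x sub interior_subset by blast+
    qed
    then show ?thesis
      by (simp add: algebra_simps)
  qed
  have T: "((\<lambda>x. stein_op q f x * q x) has_integral 0) ?U"
    using has_integral_stein_op[OF q fq] .
  have "((\<lambda>x. stein_op p f x * q x) has_integral I) ?U \<longleftrightarrow>
    ((\<lambda>x. f x * score_diff p q x * q x + stein_op q f x * q x) has_integral I) ?U"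
    by (rule has_integral_cong) (rule eq)
  also have "\<dots> \<longleftrightarrow> ((\<lambda>x. f x * score_diff p q x * q x) has_integral I) ?U"
    using has_integral_add[OF _ T, of "\<lambda>x. f x * score_diff p q x * q x" I]
      has_integral_diff[OF _ T, of "\<lambda>x. f x * score_diff p q x * q x + stein_op q f x * q x" I]
    by auto
  finally have iff: "((\<lambda>x. stein_op p f x * q x) has_integral I) ?U \<longleftrightarrow>
    ((\<lambda>x. f x * score_diff p q x * q x) has_integral I) ?U" .
  have "convex (supp q)"
    using q by (simp add: dens_class_def is_interval_convex)
  then have "negligible (frontier (supp q))"
    by (rule negligible_convex_frontier)
  from iff[unfolded has_integral_interior[OF this]] show ?thesis .
qed

theorem lemma3p1:
  fixes p q :: "real \<Rightarrow> real"
  assumes "p \<in> dens_class" and "q \<in> dens_class"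
    and "supp q \<subseteq> supp p"
    and "test_class p \<inter> test_class q \<noteq> {}"
  shows "\<forall>f \<in> test_class p \<inter> test_class q.
    (\<forall>x. (x \<in> supp p \<longrightarrow> (\<lambda>y. f y * p y) differentiable (at x)) \<longrightarrow>
         (x \<in> supp q \<longrightarrow> (\<lambda>y. f y * q y) differentiable (at x) \<and>
            p differentiable (at x) \<and> q differentiable (at x)) \<longrightarrow>
         stein_op p f x = stein_op q f x + f x * score_diff p q x
           + stein_op p f x * indicator (supp p - supp q) x) \<and>
    (has_expect q (stein_op p f) \<longleftrightarrow> has_expect q (\<lambda>x. f x * score_diff p q x)) \<and>
    expect q (stein_op p f) = expect q (\<lambda>x. f x * score_diff p q x)"
proof (intro ballI conjI allI impI)
  fix f x
  assume "f \<in> test_class p \<inter> test_class q"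
    and fp: "x \<in> supp p \<longrightarrow> (\<lambda>y. f y * p y) differentiable (at x)"
    and d: "x \<in> supp q \<longrightarrow> (\<lambda>y. f y * q y) differentiable (at x) \<and>
      p differentiable (at x) \<and> q differentiable (at x)"
  show "stein_op p f x = stein_op q f x + f x * score_diff p q x
      + stein_op p f x * indicator (supp p - supp q) x"
  proof (cases "x \<in> supp q")
    case True
    then show ?thesis
      using fp d assms(3) stein_op_eq_on_supp[of f p x q] by auto
  next
    case False
    then show ?thesis
      by (simp add: stein_op_def score_diff_def)
  qed
next
  fix f
  assume f: "f \<in> test_class p \<inter> test_class q"
  have iff: "((\<lambda>x. stein_op p f x * q x) has_integral I) (supp q) \<longleftrightarrow>
    ((\<lambda>x. f x * score_diff p q x * q x) has_integral I) (supp q)" for I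
    using f by (intro has_integral_stein_op_iff_score[OF assms(1-3)]) auto
  show "has_expect q (stein_op p f) \<longleftrightarrow> has_expect q (\<lambda>x. f x * score_diff p q x)"
    by (simp add: has_expect_def integrable_on_def iff)
  show "expect q (stein_op p f) = expect q (\<lambda>x. f x * score_diff p q x)"
    by (simp add: expect_def integral_def integrable_on_def iff)
qed

end
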